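(* Let $\mathcal{D}$ be a Ryser design of order $v$, index $\lambda$, replication numbers $r_1>r_2$, having exactly two block sizes $k_1>k_2$. Let $c,d,a,x,y$ be as defined in the context. (a) If $k_1=2\lambda+t_1a$ with $2t_1c+\lambda>e_2$, that is $2t_1>x$, then $\mathcal{D}$ is of Type-1. (b) If $k_2=2\lambda-t_2a$ with $2t_2d+\lambda>e_1$, that is $2t_2>y$, then $\mathcal{D}$ is of Type-1.
   Context: A Ryser design of order $v$ and index $\lambda$ is a pair $(X,L)$ where $X$ is a set of $v$ points and $L$ is a collection of $v$ subsets (blocks) of $X$ such that any two distinct blocks meet in exactly $\lambda$ points, every block has size $>\lambda$, and there exist two blocks of different sizes. It is known that there are integers $r_1>r_2$ with $r_1+r_2=v+1$ such that every point lies in exactly $r_1$ or exactly $r_2$ blocks. Let $e_i$ be the number of points with replication number $r_i$. Write $(r_1-1)/(r_2-1)=c/d$ with $\gcd(c,d)=1$, and $a=c-d$. Every block size has the form $2\lambda+ta$ for an integer $t$. Then $c\mid e_2-\lambda$ and $d\mid e_1-\lambda$; set $x=(e_2-\lambda)/c$ and $y=(e_1-\lambda)/d$, so $e_2=\lambda+xc$, $e_1=\lambda+yd$. A symmetric $(v,k,\mu)$ design is a set of $v$ points with $v$ blocks, each of size $k$, any two distinct blocks meeting in $\mu\ge1$ points, $k>\mu$. Given such a design with block set $\mathcal{A}$ and a fixed block $A$, the collection $\{A\}\cup\{A\triangle B: B\in\mathcal{A}, B\ne A\}$ (when $k\ne2\mu$) is a Ryser design; a Ryser design obtained in this way is of Type-1.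 *)

theory Defs
  imports Complex_Main
begin

definition ryser_design :: "'a set \<Rightarrow> 'a set set \<Rightarrow> nat \<Rightarrow> nat \<Rightarrow> bool" where
  "ryser_design X L v lam \<longleftrightarrow>
     finite X \<and> card X = v \<and> L \<subseteq> Pow X \<and> card L = v \<and>
     (\<forall>A\<in>L. \<forall>B\<in>L. A \<noteq> B \<longrightarrow> card (A \<inter> B) = lam) \<and>
     (\<forall>A\<in>L. card A > lam) \<and>
     (\<exists>A\<in>L. \<exists>B\<in>L. card A \<noteq> card B)"

definition replication :: "'a set set \<Rightarrow> 'a \<Rightarrow> nat" where
  "replication L p = card {B \<in> L. p \<in> B}"

text \<open>By the Ryser--Woodall theorem every Ryser design has such a pair of numbers; they are
  determined by the design.\<close>

definition replication_numbers :: "'a set \<Rightarrow> 'a set set \<Rightarrow> nat \<Rightarrow> nat \<Rightarrow> bool" where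
  "replication_numbers X L r1 r2 \<longleftrightarrow>
     r1 > r2 \<and> r1 + r2 = card X + 1 \<and>
     (\<forall>p\<in>X. replication L p = r1 \<or> replication L p = r2)"

definition symmetric_design :: "'a set \<Rightarrow> 'a set set \<Rightarrow> nat \<Rightarrow> nat \<Rightarrow> nat \<Rightarrow> bool" where
  "symmetric_design X \<A> v k \<mu> \<longleftrightarrow>
     finite X \<and> card X = v \<and> \<A> \<subseteq> Pow X \<and> card \<A> = v \<and>
     (\<forall>B\<in>\<A>. card B = k) \<and>
     (\<forall>B\<in>\<A>. \<forall>C\<in>\<A>. B \<noteq> C \<longrightarrow> card (B \<inter> C) = \<mu>) \<and>
     \<mu> \<ge> 1 \<and> k > \<mu>"

definition block_complementation :: "'a set set \<Rightarrow> 'a set \<Rightarrow> 'a set set" where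
  "block_complementation \<A> A = insert A {sym_diff A B | B. B \<in> \<A> \<and> B \<noteq> A}"

definition type_1 :: "'a set \<Rightarrow> 'a set set \<Rightarrow> bool" where
  "type_1 X L \<longleftrightarrow>
     (\<exists>v k \<mu> \<A> A. symmetric_design X \<A> v k \<mu> \<and> k \<noteq> 2 * \<mu> \<and> A \<in> \<A> \<and>
        L = block_complementation \<A> A)"

end

theory Submission
  imports Defs "Jordan_Normal_Form.Determinant"
begin

text \<open>
  If \<open>2 t1 c + lam > e2\<close>, two blocks of size \<open>k1\<close> would share more than \<open>lam\<close> points of
  replication number \<open>r2\<close>, so a single block \<open>A\<close> has size \<open>k1\<close>; part (b) is the same with the
  roles of the two classes exchanged. The replication function and suitable multiples of \<open>1\<close> and
  of the indicator of \<open>A\<close> have the same sum over every block, and since the incidence matrix is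
  nonsingular this forces the replication number to be a function of membership in \<open>A\<close>.
  Counting flags through another block \<open>B\<close> then gives \<open>card B = 2 * lam\<close>, which makes the
  complementation of \<open>L\<close> with respect to \<open>A\<close> a symmetric design.
\<close>

section \<open>Linear algebra: nonsingularity of the incidence matrix\<close>

text \<open>A square matrix and its transpose have the same determinant, so a trivial left kernel
  forces a trivial right one. The bijections \<open>f\<close> and \<open>h\<close> with
  \<open>{0..<n}\<close> carry the set-indexed family to a genuine matrix and back.\<close>

lemma square_matrix_trivial_kernel:
  fixes M :: "'i \<Rightarrow> 'j \<Rightarrow> real"
  assumes "finite I" "finite J" "card I = card J"
    and rows: "\<And>z. (\<forall>j\<in>J. (\<Sum>i\<in>I. z i * M i j) = 0) \<Longrightarrow> \<forall>i\<in>I. z i = 0"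
    and g: "\<forall>i\<in>I. (\<Sum>j\<in>J. M i j * g j) = 0"
  shows "\<forall>j\<in>J. g j = 0"
proof -
  define n where "n = card J"
  obtain f h where f: "bij_betw f {0..<n} I" and h: "bij_betw h {0..<n} J"
    using assms(1-3) unfolding n_def by (metis ex_bij_betw_nat_finite)
  define N where "N = mat n n (\<lambda>(i, j). M (f i) (h j))"
  have N: "N \<in> carrier_mat n n" by (simp add: N_def)
  have "det N\<^sup>T \<noteq> 0"
  proof
    assume "det N\<^sup>T = 0"
    then obtain u where u: "u \<in> carrier_vec n" "u \<noteq> 0\<^sub>v n" "N\<^sup>T *\<^sub>v u = 0\<^sub>v n"
      using det_0_iff_vec_prod_zero[of "N\<^sup>T" n] N by auto
    define z where "z i = u $ (the_inv_into {0..<n} f i)" for i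
    have zf: "z (f i) = u $ i" if "i < n" for i
      using f that by (simp add: z_def bij_betw_def the_inv_into_f_f)
    have "(\<Sum>i\<in>I. z i * M i j) = 0" if j: "j \<in> J" for j
    proof -
      obtain m where m: "m < n" "j = h m" using h j by (auto simp: bij_betw_def)
      have "(\<Sum>i\<in>I. z i * M i j) = (\<Sum>i\<in>{0..<n}. z (f i) * M (f i) j)"
        by (rule sum.reindex_bij_betw[OF f, symmetric])
      also have "\<dots> = (N\<^sup>T *\<^sub>v u) $ m"
        using m u(1) zf by (auto simp: N_def scalar_prod_def intro!: sum.cong)
      finally show ?thesis using u(3) m by simp
    qed
    then have "\<forall>i\<in>I. z i = 0" using rows by blast
    then have "u = 0\<^sub>v n" using u(1) zf f by (intro eq_vecI) (auto simp: bij_betw_def)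
    with u(2) show False by simp
  qed
  then have d: "det N \<noteq> 0" using det_transpose[OF N] by simp
  define u where "u = vec n (\<lambda>j. g (h j))"
  have "N *\<^sub>v u = 0\<^sub>v n"
  proof (rule eq_vecI)
    fix m assume "m < dim_vec (0\<^sub>v n :: real vec)"
    then have m: "m < n" by simp
    have "(N *\<^sub>v u) $ m = (\<Sum>j\<in>{0..<n}. M (f m) (h j) * g (h j))"
      using m by (auto simp: N_def u_def scalar_prod_def intro!: sum.cong)
    also have "\<dots> = (\<Sum>j\<in>J. M (f m) j * g j)"
      by (rule sum.reindex_bij_betw[OF h])
    also have "\<dots> = 0" using g f m by (auto simp: bij_betw_def)
    finally show "(N *\<^sub>v u) $ m = 0\<^sub>v n $ m" using m by simp
  qed (simp add: N_def)
  then have "u = 0\<^sub>v n"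
    using det_0_iff_vec_prod_zero[OF N] d by (metis u_def vec_carrier)
  then have "g (h j) = 0" if "j < n" for j
    using that by (metis index_vec index_zero_vec(1) u_def)
  then show ?thesis using h by (force simp: bij_betw_def)
qed

lemma ryser_designD:
  assumes "ryser_design X L v lam"
  shows "finite X" "card X = v" "finite L" "card L = v"
    and "\<And>A. A \<in> L \<Longrightarrow> A \<subseteq> X" "\<And>A. A \<in> L \<Longrightarrow> finite A" "\<And>A. A \<in> L \<Longrightarrow> card A > lam"
    and "\<And>A B. A \<in> L \<Longrightarrow> B \<in> L \<Longrightarrow> A \<noteq> B \<Longrightarrow> card (A \<inter> B) = lam"
    and "\<exists>A\<in>L. \<exists>B\<in>L. card A \<noteq> card B"
proof -
  show fin: "finite X" and "card X = v" "card L = v" and sub: "\<And>A. A \<in> L \<Longrightarrow> A \<subseteq> X"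
    and "\<And>A. A \<in> L \<Longrightarrow> card A > lam"
    and "\<And>A B. A \<in> L \<Longrightarrow> B \<in> L \<Longrightarrow> A \<noteq> B \<Longrightarrow> card (A \<inter> B) = lam"
    and "\<exists>A\<in>L. \<exists>B\<in>L. card A \<noteq> card B"
    using assms unfolding ryser_design_def by blast+
  show "finite A" if "A \<in> L" for A using finite_subset[OF sub[OF that] fin] .
  show "finite L" using sub fin by (meson PowI finite_Pow_iff finite_subset subsetI)
qed

text \<open>The Gram matrix of the blocks is a positive diagonal matrix plus \<open>lam\<close> times the all-ones
  matrix, hence positive definite.\<close>

lemma ryser_design_orthogonal_imp_zero:
  assumes R: "ryser_design X L v lam"
    and g: "\<And>B. B \<in> L \<Longrightarrow> (\<Sum>p\<in>B. g p :: real) = 0"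
  shows "\<forall>p\<in>X. g p = 0"
proof (rule square_matrix_trivial_kernel[where I = L and M = "\<lambda>B p. of_bool (p \<in> B)"])
  note D = ryser_designD[OF R]
  show "finite L" "finite X" "card L = card X" using D by auto
  have ind: "(\<Sum>p\<in>X. of_bool (p \<in> B) * h p) = (\<Sum>p\<in>B. h p)" if "B \<in> L" for B and h :: "'a \<Rightarrow> real"
    using D(1,5) that by (intro sum.mono_neutral_cong_right) auto
  show "\<forall>B\<in>L. (\<Sum>p\<in>X. of_bool (p \<in> B) * g p) = 0" using ind g by auto
  fix z :: "'a set \<Rightarrow> real"
  assume z: "\<forall>p\<in>X. (\<Sum>B\<in>L. z B * of_bool (p \<in> B)) = 0"
  have inner: "(\<Sum>p\<in>X. of_bool (p \<in> B) * of_bool (p \<in> C)) =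
      real lam + (if B = C then real (card B) - real lam else 0)" if "B \<in> L" "C \<in> L" for B C
  proof -
    have "(\<Sum>p\<in>X. of_bool (p \<in> B) * of_bool (p \<in> C)) = (\<Sum>p\<in>B \<inter> C. 1::real)"
      using D(1) D(5)[OF that(1)] by (intro sum.mono_neutral_cong_right) auto
    also have "\<dots> = card (B \<inter> C)" by simp
    finally show ?thesis using D(8)[OF that] by auto
  qed
  \<comment> \<open>Expand the squared length of the vanishing combination of block indicators with
    coefficients \<open>z\<close>. By \<open>inner\<close> it becomes a square times
    \<open>lam\<close> plus a sum of squares with the positive weights
    \<open>card B - lam\<close>.\<close>
  have "0 = (\<Sum>p\<in>X. (\<Sum>B\<in>L. z B * of_bool (p \<in> B)) * (\<Sum>C\<in>L. z C * of_bool (p \<in> C)))"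
    using z by simp
  also have "\<dots> = (\<Sum>p\<in>X. \<Sum>B\<in>L. \<Sum>C\<in>L. z B * z C * (of_bool (p \<in> B) * of_bool (p \<in> C)))"
    by (simp add: sum_product mult_ac)
  also have "\<dots> = (\<Sum>B\<in>L. \<Sum>p\<in>X. \<Sum>C\<in>L. z B * z C * (of_bool (p \<in> B) * of_bool (p \<in> C)))"
    by (rule sum.swap)
  also have "\<dots> = (\<Sum>B\<in>L. \<Sum>C\<in>L. z B * z C * (\<Sum>p\<in>X. of_bool (p \<in> B) * of_bool (p \<in> C)))"
    unfolding sum_distrib_left by (intro sum.cong refl sum.swap)
  also have "\<dots> = (\<Sum>B\<in>L. \<Sum>C\<in>L. z B * z C * real lam +
      (if B = C then z B * z B * (real (card B) - real lam) else 0))"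
    by (intro sum.cong refl) (auto simp: inner distrib_left simp del: sum_of_bool_mult_eq)
  also have "\<dots> = real lam * (\<Sum>B\<in>L. z B)\<^sup>2 + (\<Sum>B\<in>L. (z B)\<^sup>2 * (real (card B) - real lam))"
    using D(3) by (simp add: sum.distrib power2_eq_square sum_product sum_distrib_left mult_ac)
  finally have "0 = real lam * (\<Sum>B\<in>L. z B)\<^sup>2 + (\<Sum>B\<in>L. (z B)\<^sup>2 * (real (card B) - real lam))" .
  moreover have "real lam * (\<Sum>B\<in>L. z B)\<^sup>2 \<ge> 0" by simp
  moreover have pos: "\<forall>B\<in>L. (z B)\<^sup>2 * (real (card B) - real lam) \<ge> 0"
    using D(7) by (force intro!: mult_nonneg_nonneg)
  then have "(\<Sum>B\<in>L. (z B)\<^sup>2 * (real (card B) - real lam)) \<ge> 0" by (intro sum_nonneg) auto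
  ultimately have "(\<Sum>B\<in>L. (z B)\<^sup>2 * (real (card B) - real lam)) = 0" by linarith
  then have "\<forall>B\<in>L. (z B)\<^sup>2 * (real (card B) - real lam) = 0"
    using pos D(3) by (subst (asm) sum_nonneg_eq_0_iff) auto
  then show "\<forall>B\<in>L. z B = 0" using D(7) by fastforce
qed

section \<open>Counting flags through a set of points\<close>

lemma sum_replication:
  assumes "finite L" "finite S"
  shows "(\<Sum>p\<in>S. replication L p) = (\<Sum>B\<in>L. card (B \<inter> S))"
proof -
  have "(\<Sum>p\<in>S. replication L p) = (\<Sum>p\<in>S. \<Sum>B\<in>L. of_bool (p \<in> B))"
    using assms by (simp add: replication_def Int_def)
  also have "\<dots> = (\<Sum>B\<in>L. \<Sum>p\<in>S. of_bool (p \<in> B))" by (rule sum.swap)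
  also have "\<dots> = (\<Sum>B\<in>L. card (B \<inter> S))"
    using assms by (simp add: Int_def conj_commute)
  finally show ?thesis .
qed

text \<open>Among the flags through points of \<open>A\<close>, the block \<open>A\<close> accounts
  for \<open>card A\<close> and each of the other \<open>v - 1\<close> blocks for
  \<open>lam\<close>.\<close>

lemma sum_replication_block:
  assumes R: "ryser_design X L v lam" and A: "A \<in> L"
  shows "(\<Sum>p\<in>A. replication L p) = card A + lam * (v - 1)"
proof -
  note D = ryser_designD[OF R]
  have "(\<Sum>p\<in>A. replication L p) = (\<Sum>B\<in>L. card (B \<inter> A))"
    using D A by (intro sum_replication) auto
  also have "\<dots> = card A + (\<Sum>B\<in>L - {A}. card (B \<inter> A))"
    using D(3) A by (subst sum.remove[of _ A]) auto
  also have "(\<Sum>B\<in>L - {A}. card (B \<inter> A)) = (\<Sum>B\<in>L - {A}. lam)"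
    using D(8) A by (intro sum.cong) auto
  finally show ?thesis using D(3,4) A by simp
qed

lemma sum_replication_split:
  assumes "finite S" "\<And>p. p \<in> S \<Longrightarrow> replication L p = r1 \<or> replication L p = r2" "r1 \<noteq> r2"
  defines "S1 \<equiv> {p \<in> S. replication L p = r1}" and "S2 \<equiv> {p \<in> S. replication L p = r2}"
  shows "(\<Sum>p\<in>S. replication L p) = card S1 * r1 + card S2 * r2" "card S = card S1 + card S2"
proof -
  have S: "S = S1 \<union> S2" "S1 \<inter> S2 = {}" "finite S1" "finite S2"
    using assms by auto
  show "card S = card S1 + card S2" using S by (metis card_Un_disjoint)
  have "(\<Sum>p\<in>S. replication L p) = (\<Sum>p\<in>S1. replication L p) + (\<Sum>p\<in>S2. replication L p)"
    using S by (metis sum.union_disjoint)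
  then show "(\<Sum>p\<in>S. replication L p) = card S1 * r1 + card S2 * r2"
    by (simp add: S1_def S2_def)
qed

section \<open>Excluding degenerate parameters\<close>

lemma ryser_design_order_ge_2:
  assumes R: "ryser_design X L v lam"
  shows "v \<ge> 2"
proof -
  note D = ryser_designD[OF R]
  obtain A B where AB: "A \<in> L" "B \<in> L" "card A \<noteq> card B" using D(9) by auto
  have "card {A, B} \<le> card L" using AB D(3) by (intro card_mono) auto
  with AB show ?thesis using D(4) by (auto simp: card_insert_if split: if_splits)
qed

text \<open>For \<open>lam = 0\<close> the \<open>v\<close> blocks would be nonempty and pairwise
  disjoint inside \<open>v\<close> points, hence all singletons, against the two different
  sizes.\<close>

lemma ryser_design_index_pos:
  assumes R: "ryser_design X L v lam"
  shows "lam > 0"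
proof (rule ccontr)
  note D = ryser_designD[OF R]
  assume "\<not> lam > 0"
  then have 0: "lam = 0" by simp
  obtain A B where AB: "A \<in> L" "B \<in> L" "card A \<noteq> card B" using D(9) by auto
  have "card (\<Union>L) = (\<Sum>B\<in>L. card B)"
  proof (rule card_Union_disjoint)
    show "pairwise disjnt L"
      using D(6,8) 0 by (auto simp: pairwise_def disjnt_def)
  qed (use D(6) in auto)
  moreover have "card (\<Union>L) \<le> v" using D(1,2,5) by (metis Union_least card_mono)
  moreover have "(\<Sum>B\<in>L. 1::nat) < (\<Sum>B\<in>L. card B)"
  proof (rule sum_strict_mono_ex1)
    show "\<forall>B\<in>L. 1 \<le> card B" using D(7) by fastforce
    have "1 < card A \<or> 1 < card B" using AB(3) D(7)[OF AB(1)] D(7)[OF AB(2)] by linarith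
    then show "\<exists>B\<in>L. 1 < card B" using AB(1,2) by blast
  qed (rule D(3))
  ultimately show False using D(4) by simp
qed

lemma replication_numbersD:
  assumes "replication_numbers X L r1 r2" and "ryser_design X L v lam"
  shows "r1 > r2" "r1 + r2 = v + 1" "\<And>p. p \<in> X \<Longrightarrow> replication L p = r1 \<or> replication L p = r2"
  using assms(1) ryser_designD(2)[OF assms(2)] by (simp_all add: replication_numbers_def)

text \<open>This makes \<open>r2 - 1\<close> positive, so that the ratio defining
  \<open>c / d\<close> is a true quotient and factors \<open>r2 - 1\<close> can be
  cancelled.\<close>

lemma ryser_design_replication_ge_2:
  assumes R: "ryser_design X L v lam" and N: "replication_numbers X L r1 r2"
  shows "r2 \<ge> 2"
proof (rule ccontr)
  note D = ryser_designD[OF R] and ND = replication_numbersD[OF N R]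
  note v = ryser_design_order_ge_2[OF R] and lam = ryser_design_index_pos[OF R]
  assume "\<not> r2 \<ge> 2"
  then consider "r2 = 0" | "r2 = 1" by linarith
  then show False
  proof cases
    case 1
    obtain A where A: "A \<in> L" using D(9) by auto
    then obtain p where p: "p \<in> A" using D(7) by (metis card.empty ex_in_conv less_nat_zero_code)
    \<comment> \<open>Here \<open>r1 = v + 1\<close> exceeds the number of blocks, so every point
      would have replication number 0, although \<open>p\<close> lies on \<open>A\<close>.\<close>
    have "replication L p \<le> v" unfolding replication_def using D(3,4) by (metis (no_types, lifting) card_mono mem_Collect_eq subsetI)
    moreover have "replication L p > 0" unfolding replication_def using A p D(3)
      by (auto simp: card_gt_0_iff)
    ultimately show False using ND(2,3) 1 p A D(5) by fastforce
  next
    case 2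
    then have r1: "r1 = v" using ND by simp
    define E1 where "E1 = {p \<in> X. replication L p = r1}"
    define E2 where "E2 = {p \<in> X. replication L p = r2}"
    have E1: "p \<in> B" if "p \<in> E1" "B \<in> L" for p B
    proof -
      have "{B \<in> L. p \<in> B} = L"
        using that D(3,4) r1 by (intro card_subset_eq) (auto simp: E1_def replication_def)
      with that show ?thesis by auto
    qed
    \<comment> \<open>Points of \<open>E1\<close> lie on all \<open>v\<close> blocks and those of
      \<open>E2\<close> on one, so the flag count through \<open>B\<close> reduces to
      \<open>card E1 * (v - 1) = lam * (v - 1)\<close>. As \<open>card B > lam\<close>, some point
      of \<open>B\<close> is left for \<open>E2\<close>.\<close>
    have cl: "card E1 = lam \<and> card (B \<inter> E2) \<ge> 1" if B: "B \<in> L" for B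
    proof -
      have rep: "replication L p = r1 \<or> replication L p = r2" if "p \<in> B" for p
        using ND(3) D(5)[OF B] that by blast
      have "{p \<in> B. replication L p = r1} = E1" "{p \<in> B. replication L p = r2} = B \<inter> E2"
        using E1 D(5)[OF B] B by (auto simp: E1_def E2_def)
      then have *: "card B + lam * (v - 1) = card E1 * v + card (B \<inter> E2)"
        "card B = card E1 + card (B \<inter> E2)"
        using sum_replication_split[of B L r1 r2, OF D(6)[OF B] rep] sum_replication_block[OF R B]
          ND(1) 2 r1 by simp_all
      then have "card E1 * (v - 1) = lam * (v - 1)" using v by (simp add: diff_mult_distrib2)
      then have "card E1 = lam" using v by simp
      with * D(7)[OF B] show ?thesis by simp
    qed
    \<comment> \<open>Each point of \<open>E2\<close> is on exactly one block and each block meets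
      \<open>E2\<close>, so \<open>E2\<close> alone already has at least \<open>v\<close> points,
      leaving no room for \<open>E1\<close>.\<close>
    have "card E2 = (\<Sum>p\<in>E2. replication L p)" by (simp add: E2_def 2)
    also have "\<dots> = (\<Sum>B\<in>L. card (B \<inter> E2))" using D by (intro sum_replication) (auto simp: E2_def)
    also have "\<dots> \<ge> (\<Sum>B\<in>L. 1)" using cl by (intro sum_mono) auto
    finally have "card E2 \<ge> v" using D(4) by simp
    moreover have "card X = card E1 + card E2"
      unfolding E1_def E2_def using D(1) ND by (intro sum_replication_split) auto
    moreover have "card E1 = lam" using cl D(9) by auto
    ultimately show False using lam D(2) by simp
  qed
qed

section \<open>Distribution of a block over the two replication classes\<close>

text \<open>With \<open>b1\<close>, \<open>b2\<close> the numbers of points of \<open>B\<close> in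
  the two classes, the flag count gives one linear equation and \<open>card B = b1 + b2\<close>
  another; they determine both numbers. The sign of \<open>t\<close> is free, so the lemma serves
  \<open>k1\<close> with \<open>t1\<close> and \<open>k2\<close> with \<open>- t2\<close>.\<close>

lemma card_block_class:
  fixes c d :: nat and t :: int
  assumes R: "ryser_design X L v lam" and N: "replication_numbers X L r1 r2"
    and cd: "(real r1 - 1) / (real r2 - 1) = real c / real d"
    and B: "B \<in> L" and size: "int (card B) = 2 * int lam + t * (int c - int d)"
  shows "int (card {p \<in> B. replication L p = r1}) = int lam - t * int d"
    and "int (card {p \<in> B. replication L p = r2}) = int lam + t * int c"
    and "0 < d" "d < c"
proof -
  note D = ryser_designD[OF R] and ND = replication_numbersD[OF N R]
  note r2 = ryser_design_replication_ge_2[OF R N]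
  have gt: "(real r1 - 1) / (real r2 - 1) > 1" using ND(1) r2 by (simp add: field_simps)
  \<comment> \<open>For \<open>d = 0\<close> the quotient \<open>c / d\<close> is 0 by convention,
    but it must exceed 1.\<close>
  then show d: "0 < d" using cd by (cases "d = 0") auto
  then show dc: "d < c" using gt cd by (simp add: field_simps)
  have "(real r1 - 1) * real d = (real r2 - 1) * real c"
    using cd r2 d by (simp add: field_simps)
  then have "real_of_int ((int r1 - 1) * int d) = real_of_int ((int r2 - 1) * int c)" by simp
  then have rcd: "(int r1 - 1) * int d = (int r2 - 1) * int c" by linarith
  define b1 where "b1 = int (card {p \<in> B. replication L p = r1})"
  define b2 where "b2 = int (card {p \<in> B. replication L p = r2})"
  have rep: "replication L p = r1 \<or> replication L p = r2" if "p \<in> B" for p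
    using ND(3) D(5)[OF B] that by blast
  have s: "card B + lam * (v - 1) = card {p \<in> B. replication L p = r1} * r1 + card {p \<in> B. replication L p = r2} * r2"
    "card B = card {p \<in> B. replication L p = r1} + card {p \<in> B. replication L p = r2}"
    using sum_replication_split[of B L r1 r2, OF D(6)[OF B] rep] sum_replication_block[OF R B] ND(1)
    by simp_all
  have v1: "int (v - 1) = (int r1 - 1) + (int r2 - 1)" using ND r2 by simp
  have "int (card B) + int lam * int (v - 1) = b1 * int r1 + b2 * int r2"
    unfolding b1_def b2_def by (simp only: s(1) flip: of_nat_add of_nat_mult)
  moreover have sum: "int (card B) = b1 + b2" using s(2) by (simp add: b1_def b2_def)
  ultimately have "(b1 - int lam) * (int r1 - 1) = (int lam - b2) * (int r2 - 1)"
    unfolding v1 by (simp add: algebra_simps)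
  then have "(b1 - int lam) * ((int r1 - 1) * int d) = (int lam - b2) * int d * (int r2 - 1)"
    by (simp add: mult_ac)
  then have "((b1 - int lam) * int c) * (int r2 - 1) = ((int lam - b2) * int d) * (int r2 - 1)"
    unfolding rcd by (simp add: mult_ac)
  then have m: "(b1 - int lam) * int c = (int lam - b2) * int d" using r2 by simp
  have b: "b1 + b2 = 2 * int lam + t * (int c - int d)" using sum size by simp
  have b1: "b1 = 2 * int lam + t * (int c - int d) - b2" using b by simp
  \<comment> \<open>Eliminating \<open>b1\<close> leaves a linear equation for \<open>b2\<close>
    whose coefficient \<open>c - d\<close> is nonzero.\<close>
  have "(b2 - (int lam + t * int c)) * (int c - int d) = 0"
    using m unfolding b1 by (simp add: algebra_simps)
  then show "int (card {p \<in> B. replication L p = r2}) = int lam + t * int c"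
    using dc by (simp add: b2_def)
  then show "int (card {p \<in> B. replication L p = r1}) = int lam - t * int d"
    using b by (simp add: b1_def b2_def algebra_simps)
qed

section \<open>Designs in which all blocks but one have the same size\<close>

lemma ryser_design_one_exceptional_block:
  assumes R: "ryser_design X L v lam" and N: "replication_numbers X L r1 r2"
    and A: "A \<in> L" and k: "\<And>B. B \<in> L \<Longrightarrow> B \<noteq> A \<Longrightarrow> card B = k" "card A \<noteq> k"
  shows "k = 2 * lam"
proof -
  note D = ryser_designD[OF R] and ND = replication_numbersD[OF N R]
  note v = ryser_design_order_ge_2[OF R] and lam = ryser_design_index_pos[OF R]
  note r2 = ryser_design_replication_ge_2[OF R N]
  obtain B where B: "B \<in> L" "B \<noteq> A" using D(9) A by metis
  have k_lam: "k > lam" using D(7)[OF B(1)] k(1)[OF B] by simp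
  \<comment> \<open>\<alpha> and \<beta> solve the 2 by 2 system \<open>solA\<close>,
    \<open>solB\<close>, which asks that \<alpha> plus \<beta> times the indicator of
    \<open>A\<close> have the flag count as its sum over \<open>A\<close> and over any other block.
    Different block sizes make \<beta> nonzero.\<close>
  define \<beta> where "\<beta> = - (real (v - 1) * real lam * (real (card A) - real k)) / (real (card A) * (real k - real lam))"
  define \<alpha> where "\<alpha> = 1 + real (v - 1) * real lam / real (card A) - \<beta>"
  have \<beta>: "\<beta> \<noteq> 0" using v lam k(2) k_lam D(7)[OF A] by (auto simp: \<beta>_def)
  have solA: "(\<alpha> + \<beta>) * real (card A) = real (card A) + real (v - 1) * real lam"
    using D(7)[OF A] by (simp add: \<alpha>_def field_simps)
  have "\<beta> * (real k - real lam) = - (real (v - 1) * real lam * (real (card A) - real k)) / real (card A)"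
    using k_lam by (simp add: \<beta>_def)
  then have solB: "\<alpha> * real k + \<beta> * real lam = real k + real (v - 1) * real lam"
    using D(7)[OF A] by (simp add: \<alpha>_def field_simps)
  define g where "g p = real (replication L p) - \<alpha> - \<beta> * of_bool (p \<in> A)" for p
  have "\<forall>p\<in>X. g p = 0"
  proof (rule ryser_design_orthogonal_imp_zero[OF R])
    fix C assume C: "C \<in> L"
    have "(\<Sum>p\<in>C. g p) = real (\<Sum>p\<in>C. replication L p) - \<alpha> * real (card C) - \<beta> * (\<Sum>p\<in>C. of_bool (p \<in> A))"
      unfolding g_def sum_subtractf of_nat_sum sum_distrib_left by simp
    also have "(\<Sum>p\<in>C. of_bool (p \<in> A)) = real (card (C \<inter> A))"
      using D(6)[OF C] by (simp add: Int_def)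
    also have "real (\<Sum>p\<in>C. replication L p) = real (card C) + real (v - 1) * real lam"
      unfolding sum_replication_block[OF R C] by simp
    finally show "(\<Sum>p\<in>C. g p) = 0"
      using solA solB k(1)[of C] C D(8)[OF C A] by (cases "C = A") (auto simp: algebra_simps)
  qed
  then have rep: "real (replication L p) = \<alpha> + \<beta> * of_bool (p \<in> A)" if "p \<in> X" for p
    using that by (auto simp: g_def)
  have AB: "card (A \<inter> B) = lam" "card (B - A) = k - lam" "A \<inter> B \<noteq> {}" "B - A \<noteq> {}"
  proof -
    show 1: "card (A \<inter> B) = lam" using D(8) A B by auto
    then show "A \<inter> B \<noteq> {}" using lam by auto
    show 2: "card (B - A) = k - lam"
      using 1 D(6)[OF B(1)] k(1)[OF B] by (metis Int_commute card_Diff_subset_Int finite_Int)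
    show "B - A \<noteq> {}" using 2 k_lam by (metis card.empty diff_is_0_eq linorder_not_less)
  qed
  \<comment> \<open>\<open>p\<close> and \<open>q\<close> represent the two parts of
    \<open>B\<close>. Since \<beta> is nonzero, \<open>s\<close> and \<open>t\<close> are
    \<open>r1\<close> and \<open>r2\<close> in some order; which is which does not matter, only
    \<open>s + t = v + 1\<close> and \<open>t \<ge> 2\<close>.\<close>
  obtain p q where pq: "p \<in> A" "p \<in> B" "q \<in> B" "q \<notin> A" using AB by blast
  define s t where "s = replication L p" and "t = replication L q"
  have BX: "B \<subseteq> X" using D(5) B by auto
  have s: "replication L u = s" if "u \<in> A \<inter> B" for u
    using rep[of u] rep[of p] that pq BX by (auto simp: s_def subset_iff)
  have t: "replication L u = t" if "u \<in> B - A" for u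
    using rep[of u] rep[of q] that pq BX by (auto simp: t_def subset_iff)
  have "s \<noteq> t" using rep[of p] rep[of q] pq BX \<beta> by (auto simp: s_def t_def subset_iff)
  moreover have "s = r1 \<or> s = r2" "t = r1 \<or> t = r2"
    using ND(3) pq BX by (auto simp: s_def t_def)
  ultimately have st: "s + t = v + 1" "t \<ge> 2" using ND(1,2) r2 by auto
  have "(\<Sum>u\<in>B. replication L u) = (\<Sum>u\<in>A \<inter> B. replication L u) + (\<Sum>u\<in>B - A. replication L u)"
    using D(6)[OF B(1)] by (metis Int_commute sum.Int_Diff)
  also have "\<dots> = lam * s + (k - lam) * t" using s t AB by simp
  finally have "k + lam * (v - 1) = lam * s + (k - lam) * t"
    using sum_replication_block[OF R B(1)] k(1)[OF B] by simp
  then have flags: "int k + int lam * int (v - 1) = int lam * int s + (int k - int lam) * int t"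
    using k_lam by (metis (no_types, lifting) less_imp_le_nat of_nat_add of_nat_diff of_nat_mult)
  have "int (v - 1) = int s + int t - 2" using st v by simp
  with flags have "(int k - 2 * int lam) * (int t - 1) = 0"
    \<comment> \<open>With \<open>v - 1 = s + t - 2\<close> the terms in \<open>s\<close> cancel
      from the flag count.\<close>
    by (simp only:) (simp add: algebra_simps)
  then show ?thesis using st by simp
qed

lemma sym_diff_sym_diff: "sym_diff A (sym_diff A B) = B"
  by auto

text \<open>Complementation with respect to \<open>A\<close> is an involution, so it is enough that
  the complement \<open>\<A>\<close> of \<open>L\<close> is a symmetric design. Its block size is
  \<open>card A\<close> and its index \<open>card A - lam\<close>, and
  \<open>k \<noteq> 2 * \<mu>\<close> there amounts to
  \<open>card A \<noteq> 2 * lam\<close>.\<close>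

lemma type_1_if_one_exceptional_block:
  assumes R: "ryser_design X L v lam" and N: "replication_numbers X L r1 r2"
    and A: "A \<in> L" and k: "\<And>B. B \<in> L \<Longrightarrow> B \<noteq> A \<Longrightarrow> card B = k" "card A \<noteq> k"
  shows "type_1 X L"
proof -
  note D = ryser_designD[OF R]
  note lam = ryser_design_index_pos[OF R]
  have k2: "k = 2 * lam" by (rule ryser_design_one_exceptional_block[OF R N A k])
  define \<A> where "\<A> = insert A (sym_diff A ` (L - {A}))"
  have inj: "inj_on (sym_diff A) (L - {A})"
    by (intro inj_onI) (metis sym_diff_sym_diff)
  have ne: "sym_diff A B \<noteq> A" if "B \<in> L" for B
  proof -
    have "B \<noteq> {}" using D(7)[OF that] by auto
    then show ?thesis by blast
  qed
  have card_A: "card \<A> = v"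
  proof -
    have "card \<A> = Suc (card (L - {A}))"
      unfolding \<A>_def using D(3) ne inj by (subst card_insert_disjoint) (auto simp: card_image)
    then show ?thesis using card_Suc_Diff1[OF D(3) A] D(4) by simp
  qed
  \<comment> \<open>The equality \<open>k = 2 * lam\<close> gives \<open>B - A\<close> exactly the
    size lost in passing from \<open>A\<close> to \<open>A - B\<close>, hence \<open>size\<close>
    below.\<close>
  have AB: "card (A - B) = card A - lam" "card (B - A) = lam" if "B \<in> L" "B \<noteq> A" for B
    using card_Diff_subset_Int[of A B] card_Diff_subset_Int[of B A] D(6)[OF A]
      D(8)[OF A that(1)] k(1)[OF that] that k2 by (simp_all add: Int_commute)
  have size: "card (sym_diff A B) = card A" if "B \<in> L" "B \<noteq> A" for B
  proof -
    have "card (sym_diff A B) = card (A - B) + card (B - A)"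
      using D(6)[OF A] D(6)[OF that(1)] by (intro card_Un_disjoint) auto
    then show ?thesis using AB[OF that] D(7)[OF A] by simp
  qed
  \<comment> \<open>The intersection splits into \<open>A - B - C\<close> and
    \<open>B \<inter> C - A\<close>. If \<open>n\<close> is the size of the triple intersection,
    these have \<open>card A - 2 * lam + n\<close> and \<open>lam - n\<close> points, so
    \<open>n\<close> cancels.\<close>
  have inter: "card (sym_diff A B \<inter> sym_diff A C) = card A - lam"
    if "B \<in> L" "C \<in> L" "B \<noteq> A" "C \<noteq> A" "B \<noteq> C" for B C
  proof -
    have f: "finite A" "finite B" "finite C" using D(6) A that by auto
    have "card (sym_diff A B \<inter> sym_diff A C) = card ((A - B) - C) + card ((B \<inter> C) - A)"
      using f by (subst card_Un_disjoint[symmetric]) (auto intro!: arg_cong[where f = card])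
    moreover have "card (A - B) = card ((A - B) - C) + card ((A \<inter> C) - B)"
      using f by (subst card_Un_disjoint[symmetric]) (auto intro!: arg_cong[where f = card])
    moreover have "card (A \<inter> C) = card ((A \<inter> C) - B) + card (A \<inter> B \<inter> C)"
      using f by (subst card_Un_disjoint[symmetric]) (auto intro!: arg_cong[where f = card])
    moreover have "card (B \<inter> C) = card ((B \<inter> C) - A) + card (A \<inter> B \<inter> C)"
      using f by (subst card_Un_disjoint[symmetric]) (auto intro!: arg_cong[where f = card])
    ultimately show ?thesis
      using AB(1)[OF that(1,3)] D(8)[OF A that(2)] D(8)[OF that(1,2,5)] that by simp
  qed
  have "A \<inter> sym_diff A B = A - B" "sym_diff A B \<inter> A = A - B" for B by auto
  then have interA: "card (A \<inter> sym_diff A B) = card A - lam" "card (sym_diff A B \<inter> A) = card A - lam"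
    if "B \<in> L" "B \<noteq> A" for B using AB(1)[OF that] by simp_all
  have "symmetric_design X \<A> v (card A) (card A - lam)"
    unfolding symmetric_design_def
  proof (intro conjI ballI impI)
    show "\<A> \<subseteq> Pow X" unfolding \<A>_def using D(5) A by blast
    show "card A - lam \<ge> 1" "card A > card A - lam" using D(7)[OF A] lam by auto
    show "card B = card A" if "B \<in> \<A>" for B using that size by (auto simp: \<A>_def)
    fix B C assume "B \<in> \<A>" "C \<in> \<A>" "B \<noteq> C"
    then consider B' where "B' \<in> L" "B' \<noteq> A" "B = A" "C = sym_diff A B'"
      | C' where "C' \<in> L" "C' \<noteq> A" "B = sym_diff A C'" "C = A"
      | B' C' where "B' \<in> L" "B' \<noteq> A" "C' \<in> L" "C' \<noteq> A" "B' \<noteq> C'"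
          "B = sym_diff A B'" "C = sym_diff A C'"
      unfolding \<A>_def by blast
    then show "card (B \<inter> C) = card A - lam"
      using inter interA by cases simp_all
  qed (simp_all add: D(1,2) card_A)
  moreover have "card A \<noteq> 2 * (card A - lam)" using D(7)[OF A] k(2) k2 by simp
  moreover have "L = block_complementation \<A> A"
  proof -
    have "{sym_diff A B | B. B \<in> \<A> \<and> B \<noteq> A} = sym_diff A ` (sym_diff A ` (L - {A}))"
      using ne by (auto simp: \<A>_def)
    also have "\<dots> = L - {A}" unfolding image_image sym_diff_sym_diff by simp
    finally show ?thesis using A by (auto simp: block_complementation_def)
  qed
  ultimately show ?thesis unfolding type_1_def using \<A>_def by blast
qed

section \<open>Uniqueness of a block by overlap in a class, and both parts of the theorem\<close>

text \<open>Two blocks of size \<open>k\<close> would each cover more than half of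
  \<open>card E + lam\<close> points within \<open>E\<close>, and so share more than
  \<open>lam\<close> points there. Leaving \<open>k\<close> and \<open>k'\<close> unordered lets
  either block size be the exceptional one.\<close>

lemma type_1_if_class_overlap:
  assumes R: "ryser_design X L v lam" and N: "replication_numbers X L r1 r2"
    and sizes: "card ` L = {k, k'}" "k \<noteq> k'"
    and E: "E \<subseteq> X"
    and overlap: "\<And>B. B \<in> L \<Longrightarrow> card B = k \<Longrightarrow> 2 * card (B \<inter> E) > card E + lam"
  shows "type_1 X L"
proof -
  note D = ryser_designD[OF R]
  have fE: "finite E" using E D(1) finite_subset by blast
  obtain A where A: "A \<in> L" "card A = k" using sizes(1) by (metis imageE insertI1)
  have "card B = k'" if B: "B \<in> L" "B \<noteq> A" for B
  proof (rule ccontr)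
    assume "card B \<noteq> k'"
    then have Bk: "card B = k" using sizes(1) B(1) by blast
    have "card (A \<inter> E) + card (B \<inter> E) = card ((A \<inter> E) \<union> (B \<inter> E)) + card ((A \<inter> E) \<inter> (B \<inter> E))"
      using fE by (intro card_Un_Int) auto
    moreover have "card ((A \<inter> E) \<union> (B \<inter> E)) \<le> card E" using fE by (intro card_mono) auto
    moreover have "card ((A \<inter> E) \<inter> (B \<inter> E)) \<le> card (A \<inter> B)"
      using D(6)[OF A(1)] by (intro card_mono) auto
    ultimately show False
      using overlap[OF A] overlap[OF B(1) Bk] D(8)[OF A(1) B(1)] B(2) by simp
  qed
  then show ?thesis
    using A sizes(2) by (intro type_1_if_one_exceptional_block[OF R N A(1)]) auto
qed

theorem theorem1p13:
  fixes X :: "'a set" and L :: "'a set set"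
    and v lam r1 r2 c d e1 e2 k1 k2 :: nat
    and a :: int and x y :: real
  assumes ryser: "ryser_design X L v lam"
    and repl: "replication_numbers X L r1 r2"
    and e1: "e1 = card {p \<in> X. replication L p = r1}"
    and e2: "e2 = card {p \<in> X. replication L p = r2}"
    and cd: "(real r1 - 1) / (real r2 - 1) = real c / real d" "coprime c d"
    and a: "a = int c - int d"
    and x: "x = (real e2 - real lam) / real c"
    and y: "y = (real e1 - real lam) / real d"
    and sizes: "card ` L = {k1, k2}" "k1 > k2"
  shows "(\<forall>t1::int. int k1 = 2 * int lam + t1 * a \<longrightarrow>
            (2 * t1 * int c + int lam > int e2 \<longleftrightarrow> real_of_int (2 * t1) > x) \<and>
            (2 * t1 * int c + int lam > int e2 \<longrightarrow> type_1 X L)) \<and>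
         (\<forall>t2::int. int k2 = 2 * int lam - t2 * a \<longrightarrow>
            (2 * t2 * int d + int lam > int e1 \<longleftrightarrow> real_of_int (2 * t2) > y) \<and>
            (2 * t2 * int d + int lam > int e1 \<longrightarrow> type_1 X L))"
proof -
  note D = ryser_designD[OF ryser] and cls = card_block_class[OF ryser repl cd(1)]
  have sub: "{p \<in> B. replication L p = r} = B \<inter> {p \<in> X. replication L p = r}" if "B \<in> L" for B r
    using D(5)[OF that] by auto
  have iff: "2 * t * int n + int lam > int e \<longleftrightarrow> real_of_int (2 * t) > (real e - real lam) / real n"
    if "n > 0" for t :: int and n e :: nat
  proof -
    have "2 * t * int n + int lam > int e \<longleftrightarrow> real_of_int (2 * t * int n + int lam) > real_of_int (int e)"
      by (simp only: of_int_less_iff)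
    then show ?thesis using that by (simp add: field_simps)
  qed
  show ?thesis
  proof (intro conjI allI impI)
    fix t1 :: int
    assume t1: "int k1 = 2 * int lam + t1 * a"
    obtain A where A: "A \<in> L" "card A = k1" using sizes(1) by (metis imageE insertI1)
    \<comment> \<open>Needed for \<open>c > 0\<close>, so that dividing by \<open>c\<close>
      preserves the inequality that defines \<open>x\<close>.\<close>
    have "d < c" using cls(4)[OF A(1), of t1] A t1 a by simp
    then show "2 * t1 * int c + int lam > int e2 \<longleftrightarrow> real_of_int (2 * t1) > x"
      unfolding x by (intro iff) simp
    assume big: "2 * t1 * int c + int lam > int e2"
    show "type_1 X L"
    proof (rule type_1_if_class_overlap[OF ryser repl sizes(1)])
      fix B assume B: "B \<in> L" "card B = k1"
      \<comment> \<open>Doubling this count turns \<open>big\<close> into the overlap condition for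
        the class of \<open>r2\<close>.\<close>
      have "int (card (B \<inter> {p \<in> X. replication L p = r2})) = int lam + t1 * int c"
        using cls(2)[OF B(1), of t1] B t1 a sub by simp
      then show "2 * card (B \<inter> {p \<in> X. replication L p = r2}) > card {p \<in> X. replication L p = r2} + lam"
        using big unfolding e2 by linarith
    qed (use sizes(2) in auto)
  next
    fix t2 :: int
    assume t2: "int k2 = 2 * int lam - t2 * a"
    obtain A where A: "A \<in> L" "card A = k2" using sizes(1) by (metis imageE insertCI)
    have "0 < d" using cls(3)[OF A(1), of "- t2"] A t2 a by simp
    then show "2 * t2 * int d + int lam > int e1 \<longleftrightarrow> real_of_int (2 * t2) > y"
      unfolding y by (rule iff)
    assume big: "2 * t2 * int d + int lam > int e1"
    show "type_1 X L"
    proof (rule type_1_if_class_overlap[OF ryser repl])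
      show "card ` L = {k2, k1}" using sizes(1) by auto
      fix B assume B: "B \<in> L" "card B = k2"
      \<comment> \<open>The smaller blocks are rich in points of the other class: the parameter
        \<open>- t2\<close> turns the deficit in \<open>r2\<close> into a surplus in
        \<open>r1\<close>.\<close>
      have "int (card (B \<inter> {p \<in> X. replication L p = r1})) = int lam + t2 * int d"
        using cls(1)[OF B(1), of "- t2"] B t2 a sub by simp
      then show "2 * card (B \<inter> {p \<in> X. replication L p = r1}) > card {p \<in> X. replication L p = r1} + lam"
        using big unfolding e1 by linarith
    qed (use sizes(2) in auto)
  qed
qed

end
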